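(* Let $p>q>1$ be coprime integers such that $p<q^2$. Suppose that for every non-empty word $u\in\mathcal{L}_{p/q}$ the minimal word $\mathtt{wmin}_{p/q}(u)$ is normal over the alphabet $\{0,\dots,q-1\}$. Then there exists no $Z_{p/q}$-number, that is, there exists no real number $x>0$ such that the fractional part $\{x(p/q)^n\}$ lies in $[0,1/q)$ for every $n\in\mathbb{N}$.
   Context: Here $\mathbb{N}=\{0,1,2,\dots\}$ and $\{y\}=y-\lfloor y\rfloor$ denotes the fractional part of a real number $y$. Rational base expansions. Let $p>q\ge 1$ be coprime integers. The expansion $\mathtt{rep}_{p/q}(n)$ of $n\in\mathbb{N}$ in base $p/q$ is the unique finite word $a_ka_{k-1}\cdots a_0$ over $\{0,\dots,p-1\}$ not starting with the letter $0$ and such that $n=\frac1q\sum_{i=0}^k a_i\left(\frac pq\right)^i$ (the expansion of $0$ is the empty word $\epsilon$). Put $\mathcal{L}_{p/q}=\{\mathtt{rep}_{p/q}(n): n\in\mathbb{N}\}$. This language is prefix-closed, and every word of it can be extended on the right by some letter of $\{0,\dots,p-1\}$ to a word of $\mathcal{L}_{p/q}$. Minimal words. For $u\in\mathcal{L}_{p/q}$, the minimal word with seed $u$, denoted $\mathtt{wmin}_{p/q}(u)$, is the unique infinite word such that, for every $l\in\mathbb{N}$, its prefix of length $l$ is the lexicographically smallest word $v\in\{0,\dots,p-1\}^l$ such that the concatenation $uv$ belongs to $\mathcal{L}_{p/q}$. (Equivalently, it is built letter by letter, starting from $u$, by always appending the smallest letter keeping the word in $\mathcal{L}_{p/q}$.)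 Normality. An infinite word $w=w_0w_1w_2\cdots$ over an alphabet $A$ with $d$ letters is normal over $A$ if for every $l\ge 1$ and every $v\in A^l$, $\lim_{N\to\infty}\frac1N\,\mathrm{Card}\{0\le m<N : w_m\cdots w_{m+l-1}=v\}=\frac{1}{d^l}$. *)

theory Defs
  imports Complex_Main
begin

text \<open>Finite words are lists whose head is the most significant (leftmost) letter; infinite words
  are functions on \<^typ>\<open>nat\<close>. The base is \<open>p/q\<close>; the notions below are
  meant for coprime \<open>p > q \<ge> 1\<close>, where the definite descriptions denote.\<close>

definition words_of_length :: "'a set \<Rightarrow> nat \<Rightarrow> 'a list set" where
  "words_of_length A l = {v. length v = l \<and> set v \<subseteq> A}"

text \<open>The letter \<open>a\<^sub>i\<close> of \<open>a\<^sub>k \<dots> a\<^sub>0\<close> is \<open>rev w ! i\<close>.\<close>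

definition eval_pq :: "nat \<Rightarrow> nat \<Rightarrow> nat list \<Rightarrow> real" where
  "eval_pq p q w = 1 / real q * (\<Sum>i<length w. real (rev w ! i) * (real p / real q) ^ i)"

definition rep_pq :: "nat \<Rightarrow> nat \<Rightarrow> nat \<Rightarrow> nat list" where
  "rep_pq p q n = (THE w. set w \<subseteq> {0..<p} \<and> (w \<noteq> [] \<longrightarrow> hd w \<noteq> 0) \<and> real n = eval_pq p q w)"

definition lang_pq :: "nat \<Rightarrow> nat \<Rightarrow> nat list set" where
  "lang_pq p q = range (rep_pq p q)"

definition is_lex_smallest :: "nat list set \<Rightarrow> nat list \<Rightarrow> bool" where
  "is_lex_smallest V v \<longleftrightarrow> v \<in> V \<and> (\<forall>v'\<in>V. lexordp_eq v v')"

definition wmin_pq :: "nat \<Rightarrow> nat \<Rightarrow> nat list \<Rightarrow> (nat \<Rightarrow> nat)" where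
  "wmin_pq p q u = (THE w. \<forall>l.
     is_lex_smallest {v \<in> words_of_length {0..<p} l. u @ v \<in> lang_pq p q} (map w [0..<l]))"

text \<open>Normality over \<open>A\<close> includes that the word is a word over \<open>A\<close>.\<close>

definition normal_word :: "'a set \<Rightarrow> (nat \<Rightarrow> 'a) \<Rightarrow> bool" where
  "normal_word A w \<longleftrightarrow> range w \<subseteq> A \<and>
     (\<forall>l\<ge>1. \<forall>v \<in> words_of_length A l.
        (\<lambda>N. real (card {m. m < N \<and> map w [m..<m + l] = v}) / real N)
          \<longlonglongrightarrow> 1 / real (card A) ^ l)"

definition Z_number :: "nat \<Rightarrow> nat \<Rightarrow> real \<Rightarrow> bool" where
  "Z_number p q x \<longleftrightarrow> x > 0 \<and> (\<forall>n. frac (x * (real p / real q) ^ n) \<in> {0..<1 / real q})"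

end

theory Submission
  imports Defs
begin

text \<open>
  Let \<open>x\<close> be a \<open>Z\<close>-number for \<open>p/q\<close>, and write \<open>x (p/q)\<^sup>n = y\<^sub>n + r\<^sub>n\<close> with \<open>y\<^sub>n\<close> a natural number
  and \<open>0 \<le> r\<^sub>n < 1/q\<close>. Then \<open>a\<^sub>n = q y\<^sub>n\<^sub>+\<^sub>1 - p y\<^sub>n = p r\<^sub>n - q r\<^sub>n\<^sub>+\<^sub>1\<close> is an integer lying strictly
  between \<open>-1\<close> and \<open>p/q < q\<close>, so it is one of the letters \<open>0, \<dots>, q - 1\<close>. Hence \<open>a\<^sub>n\<close> is the only
  letter below \<open>q\<close> by which the expansion of \<open>y\<^sub>n\<close> can be extended, and so the least one: as soon as
  \<open>y\<^sub>n > 0\<close>, the word \<open>a\<^sub>n a\<^sub>n\<^sub>+\<^sub>1 \<dots>\<close> is the minimal word with the expansion of \<open>y\<^sub>n\<close> as its seed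
  (\<open>wmin_pq_eqI\<close>).

  If this word is normal, it contains arbitrarily long runs of the letter \<open>q - 1\<close>. Along such a
  run \<open>r\<close> moves by the affine map \<open>r \<mapsto> (p r - (q - 1)) / q\<close>, which expands by the factor \<open>p/q > 1\<close>
  away from its fixed point \<open>(q - 1)/(p - q)\<close>. The hypothesis \<open>p < q\<^sup>2\<close> says exactly that this fixed
  point exceeds \<open>1/q\<close>, so \<open>r\<close> starts at a definite distance below it, and a long run drives \<open>r\<close> below
  \<open>0\<close> (\<open>top_letter_runs_bounded\<close>), which is absurd.
\<close>

section \<open>Expansions in a rational base\<close>

lemma eval_pq_Nil [simp]: "eval_pq p q [] = 0"
  by (simp add: eval_pq_def)

lemma eval_pq_snoc: "eval_pq p q (w @ [a]) = (real p * eval_pq p q w + real a) / real q"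
proof -
  have "(\<Sum>i<length (w @ [a]). real (rev (w @ [a]) ! i) * (real p / real q) ^ i)
      = real a + (\<Sum>i<length w. real (rev w ! i) * (real p / real q) ^ Suc i)"
    by (simp add: sum.lessThan_Suc_shift del: sum.lessThan_Suc power_Suc)
  also have "\<dots> = real a + real p / real q * (\<Sum>i<length w. real (rev w ! i) * (real p / real q) ^ i)"
    by (simp add: sum_distrib_left mult_ac)
  finally show ?thesis
    by (simp add: eval_pq_def field_simps)
qed

definition is_rep :: "nat \<Rightarrow> nat \<Rightarrow> nat \<Rightarrow> nat list \<Rightarrow> bool" where
  "is_rep p q n w \<longleftrightarrow>
     set w \<subseteq> {0..<p} \<and> (w \<noteq> [] \<longrightarrow> hd w \<noteq> 0) \<and> real n = eval_pq p q w"

locale rational_base =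
  fixes p q :: nat
  assumes q_pos: "0 < q" and q_less_p: "q < p" and coprime_pq: "coprime p q"
begin

lemma eval_pq_times_power_nat: "\<exists>M. eval_pq p q w * real q ^ length w = real M"
proof (induction w rule: rev_induct)
  case Nil
  show ?case by (rule exI[of _ 0]) simp
next
  case (snoc a w)
  then obtain M where M: "eval_pq p q w * real q ^ length w = real M" by blast
  have "eval_pq p q (w @ [a]) * real q ^ length (w @ [a])
      = real p * (eval_pq p q w * real q ^ length w) + real a * real q ^ length w"
    using q_pos by (simp add: eval_pq_snoc field_simps)
  also have "\<dots> = real (p * M + a * q ^ length w)"
    by (simp add: M)
  finally show ?case by blast
qed

text \<open>
  A prefix of a word with integral value again has integral value: its value is both an integer
  divided by \<open>p\<close> and an integer divided by a power of \<open>q\<close>, and these denominators are coprime.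
\<close>

lemma eval_pq_snoc_nat:
  assumes "eval_pq p q (w @ [a]) = real n"
  obtains m where "eval_pq p q w = real m" and "q * n = p * m + a"
proof -
  obtain M where M: "eval_pq p q w * real q ^ length w = real M"
    using eval_pq_times_power_nat by blast
  have scaled: "real p * eval_pq p q w + real a = real q * real n"
    using assms q_pos by (simp add: eval_pq_snoc field_simps)
  have "real (p * M + a * q ^ length w)
      = (real p * eval_pq p q w + real a) * real q ^ length w"
    by (simp add: M[symmetric] algebra_simps)
  also have "\<dots> = real (q * n * q ^ length w)"
    by (simp add: scaled)
  finally have "p * M + a * q ^ length w = q * n * q ^ length w"
    by (simp only: of_nat_eq_iff)
  then have "q ^ length w dvd p * M"
    by (metis dvd_add_left_iff dvd_triv_right)
  moreover have "coprime (q ^ length w) p"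
    using coprime_pq by (simp add: coprime_commute)
  ultimately have "q ^ length w dvd M"
    using coprime_dvd_mult_right_iff by blast
  then obtain m where m: "M = q ^ length w * m" ..
  have "eval_pq p q w = real m"
    using M q_pos by (simp add: m)
  moreover from this scaled have "real (q * n) = real (p * m + a)"
    by simp
  then have "q * n = p * m + a"
    by (simp only: of_nat_eq_iff)
  ultimately show thesis by (rule that)
qed

lemma is_rep_snocD:
  assumes "is_rep p q n (w @ [a])"
  obtains m where "is_rep p q m w" and "q * n = p * m + a" and "a < p"
proof -
  obtain m where "eval_pq p q w = real m" and "q * n = p * m + a"
    using eval_pq_snoc_nat[of w a n] assms unfolding is_rep_def by auto
  with assms show thesis
    by (intro that[of m]) (auto simp: is_rep_def hd_append split: if_splits)
qed

lemma is_rep_0_iff: "is_rep p q 0 w \<longleftrightarrow> w = []"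
proof
  show "w = []" if "is_rep p q 0 w"
    using that
  proof (induction w rule: rev_induct)
    case (snoc a w)
    obtain m where "is_rep p q m w" and "q * 0 = p * m + a"
      using snoc.prems by (rule is_rep_snocD)
    then have "a = 0" and "is_rep p q 0 w"
      using q_less_p by auto
    then show ?case
      using snoc by (simp add: is_rep_def)
  qed simp
qed (simp add: is_rep_def)

text \<open>
  The last letter and the value of the remaining prefix are forced: they are the remainder and the
  quotient of \<open>q n\<close> by \<open>p\<close>.
\<close>

lemma is_rep_unique: "is_rep p q n w \<Longrightarrow> is_rep p q n w' \<Longrightarrow> w = w'"
proof (induction w arbitrary: n w' rule: rev_induct)
  case Nil
  then have "n = 0" by (simp add: is_rep_def)
  with Nil show ?case by (simp add: is_rep_0_iff)
next
  case (snoc a w)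
  have "w' \<noteq> []"
  proof
    assume "w' = []"
    with snoc.prems(2) have "n = 0" by (simp add: is_rep_def)
    with snoc.prems(1) show False by (simp add: is_rep_0_iff)
  qed
  then obtain w'' a' where w': "w' = w'' @ [a']"
    by (metis rev_exhaust)
  obtain m where m: "is_rep p q m w" "q * n = p * m + a" "a < p"
    using snoc.prems(1) by (rule is_rep_snocD)
  obtain m' where m': "is_rep p q m' w''" "q * n = p * m' + a'" "a' < p"
    using snoc.prems(2) unfolding w' by (rule is_rep_snocD)
  have "a = q * n mod p" "m = q * n div p" using m by simp_all
  moreover have "a' = q * n mod p" "m' = q * n div p" using m' by simp_all
  ultimately show ?case
    using snoc.IH m(1) m'(1) w' by simp
qed

lemma is_rep_exists: "\<exists>w. is_rep p q n w"
proof (induction n rule: less_induct)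
  case (less n)
  show ?case
  proof (cases "n = 0")
    case True
    then show ?thesis by (auto simp: is_rep_0_iff)
  next
    case False
    define m where "m = q * n div p"
    define a where "a = q * n mod p"
    have eq: "q * n = p * m + a" and a: "a < p"
      using q_less_p by (simp_all add: m_def a_def)
    have "m < n"
      using False q_less_p unfolding m_def by (simp add: div_less_iff_less_mult mult.commute)
    with less obtain w where w: "is_rep p q m w" by blast
    have "real q * real n = real p * real m + real a"
      using arg_cong[OF eq, of real] by simp
    then have "real n = eval_pq p q (w @ [a])"
      using w q_pos by (simp add: eval_pq_snoc is_rep_def field_simps)
    moreover have "a \<noteq> 0" if "w = []"
      using that w eq False q_pos by (auto simp: is_rep_def)
    ultimately have "is_rep p q n (w @ [a])"
      using w a by (auto simp: is_rep_def hd_append)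
    then show ?thesis by blast
  qed
qed

lemma is_rep_rep_pq: "is_rep p q n (rep_pq p q n)"
proof -
  have "\<exists>!w. is_rep p q n w"
    using is_rep_exists is_rep_unique by blast
  then show ?thesis
    unfolding rep_pq_def is_rep_def by (rule theI')
qed

lemma lang_pq_iff: "w \<in> lang_pq p q \<longleftrightarrow> (\<exists>n. is_rep p q n w)"
  unfolding lang_pq_def using is_rep_rep_pq is_rep_unique by blast

end

section \<open>Minimal words\<close>

text \<open>
  For words of equal length a strict inequality is decided before the last letter, so the appended
  letters matter only when the words agree.
\<close>

lemma lexordp_eq_snocI:
  fixes v w :: "'a::linorder list"
  assumes "lexordp_eq v w" "length v = length w" "v = w \<Longrightarrow> a \<le> b"
  shows "lexordp_eq (v @ [a]) (w @ [b])"
  using assms(2,1,3)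
proof (induction v w rule: list_induct2)
  case Nil
  then show ?case by (cases "a = b") auto
next
  case (Cons x xs y ys)
  then show ?case by auto
qed

context rational_base
begin

text \<open>
  Extending a word of value \<open>y k\<close> by a letter \<open>b\<close> keeps its value integral only if \<open>q\<close> divides
  \<open>p * y k + b\<close>. This fixes \<open>b\<close> modulo \<open>q\<close>, so a letter below \<open>q\<close> that qualifies is the least one.
\<close>

lemma wmin_pq_eqI:
  fixes y a :: "nat \<Rightarrow> nat"
  assumes u: "is_rep p q (y 0) u" "u \<noteq> []"
    and step: "\<And>k. q * y (Suc k) = p * y k + a k"
    and a_less: "\<And>k. a k < q"
  shows "wmin_pq p q u = a"
proof -
  define V where "V l = {v \<in> words_of_length {0..<p} l. u @ v \<in> lang_pq p q}" for l
  have rep: "is_rep p q (y l) (u @ map a [0..<l])" for l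
  proof (induction l)
    case (Suc l)
    have "real q * real (y (Suc l)) = real p * real (y l) + real (a l)"
      using arg_cong[OF step[of l], of real] by simp
    then have "real (y (Suc l)) = eval_pq p q ((u @ map a [0..<l]) @ [a l])"
      using Suc q_pos unfolding eval_pq_snoc by (simp add: is_rep_def field_simps)
    then show ?case
      using Suc u(2) less_trans[OF a_less q_less_p] by (simp add: is_rep_def)
  qed (simp add: u)
  have smallest: "is_lex_smallest (V l) (map a [0..<l])" for l
  proof -
    have "map a [0..<l] \<in> V l"
      using rep[of l] less_trans[OF a_less q_less_p]
      by (auto simp: V_def words_of_length_def lang_pq_iff)
    moreover have "lexordp_eq (map a [0..<l]) v" if "v \<in> V l" for v
      using that
    proof (induction l arbitrary: v)
      case (Suc l)
      then obtain v' b where v: "v = v' @ [b]" "length v' = l"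
        by (auto simp: V_def words_of_length_def length_Suc_conv_rev)
      obtain n where "is_rep p q n ((u @ v') @ [b])"
        using Suc.prems by (auto simp: V_def v lang_pq_iff)
      then obtain m where m: "is_rep p q m (u @ v')" "q * n = p * m + b"
        by (rule is_rep_snocD)
      have "v' \<in> V l"
        using Suc.prems m(1) by (auto simp: V_def v words_of_length_def lang_pq_iff)
      then have le: "lexordp_eq (map a [0..<l]) v'"
        by (rule Suc.IH)
      have "a l \<le> b" if "map a [0..<l] = v'"
      proof -
        have "m = y l"
          using m(1) rep[of l] that by (simp add: is_rep_def)
        then have "q * n = p * y l + b"
          using m(2) by simp
        then have "q dvd a l - b"
          using step[of l] by (metis add_diff_cancel_left dvd_diff_nat dvd_triv_left)
        then have "a l - b = 0"
          using a_less[of l] by (meson dvd_imp_le le_less_trans diff_le_self linorder_not_less not_gr_zero)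
        then show ?thesis
          by simp
      qed
      with le show ?case
        by (simp add: v lexordp_eq_snocI)
    qed simp
    ultimately show ?thesis
      by (simp add: is_lex_smallest_def)
  qed
  have "w = a" if "\<forall>l. is_lex_smallest (V l) (map w [0..<l])" for w
  proof
    fix k
    have "map w [0..<Suc k] = map a [0..<Suc k]"
      using that smallest[of "Suc k"] unfolding is_lex_smallest_def
      by (meson lexordp_eq_antisym)
    then show "w k = a k" by simp
  qed
  with smallest show ?thesis
    unfolding wmin_pq_def V_def[symmetric] by (intro the_equality) blast+
qed

end

section \<open>Runs of the largest letter\<close>

lemma normal_word_factor_occurs:
  assumes "normal_word A w" "finite A" "A \<noteq> {}" "v \<in> words_of_length A l" "1 \<le> l"
  obtains m where "map w [m..<m + l] = v"
proof -
  have "\<exists>m. map w [m..<m + l] = v"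
  proof (rule ccontr)
    assume "\<nexists>m. map w [m..<m + l] = v"
    then have "(\<lambda>N. real (card {m. m < N \<and> map w [m..<m + l] = v}) / real N) = (\<lambda>N. 0)"
      by simp
    moreover have "(\<lambda>N. real (card {m. m < N \<and> map w [m..<m + l] = v}) / real N)
        \<longlonglongrightarrow> 1 / real (card A) ^ l"
      using assms by (simp add: normal_word_def)
    ultimately have "1 / real (card A) ^ l = 0"
      by (simp add: LIMSEQ_const_iff)
    then show False
      using assms by simp
  qed
  then show thesis using that by blast
qed

text \<open>
  The distance of \<open>r i\<close> below the fixed point \<open>c = (Q - 1) / (P - Q)\<close> of the recurrence is multiplied
  by \<open>P/Q\<close> in each step. Initially it exceeds \<open>c - 1/Q > 0\<close>, while nonnegativity of \<open>r L\<close> caps it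
  at \<open>c\<close> in the end. The length \<open>L\<close> must not depend on \<open>r\<close>, because normality yields a run of a
  length chosen beforehand.
\<close>

lemma top_letter_runs_bounded:
  fixes P Q :: real
  assumes "1 < Q" "Q < P" "P < Q\<^sup>2"
  obtains L :: nat where "1 \<le> L"
    "\<And>r :: nat \<Rightarrow> real. \<lbrakk>r 0 < 1 / Q; 0 \<le> r L; \<And>i. i < L \<Longrightarrow> P * r i - Q * r (Suc i) = Q - 1\<rbrakk> \<Longrightarrow> False"
proof -
  define c where "c = (Q - 1) / (P - Q)"
  have c: "(P - Q) * c = Q - 1"
    using assms by (simp add: c_def)
  \<comment> \<open>After clearing denominators this is \<open>P < Q\<^sup>2\<close>.\<close>
  have gap: "0 < c - 1 / Q"
    using assms by (simp add: c_def field_simps power2_eq_square)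
  have "1 < P / Q"
    using assms by simp
  then obtain L where L: "c / (c - 1 / Q) < (P / Q) ^ L"
    using real_arch_pow by blast
  have "1 < c / (c - 1 / Q)"
    using gap assms by (simp add: field_simps)
  with L have "1 \<le> L"
    by (cases L) auto
  moreover have False
    if r: "r 0 < 1 / Q" "0 \<le> r L" "\<And>i. i < L \<Longrightarrow> P * r i - Q * r (Suc i) = Q - 1"
    for r :: "nat \<Rightarrow> real"
  proof -
    have "c - r i = (P / Q) ^ i * (c - r 0)" if "i \<le> L" for i
      using that
    proof (induction i)
      case (Suc i)
      have "Q * (c - r (Suc i)) = P * (c - r i)"
        using r(3)[of i] Suc.prems c by (simp add: algebra_simps)
      then have "c - r (Suc i) = P / Q * (c - r i)"
        using assms by (simp add: field_simps)
      with Suc show ?case by simp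
    qed simp
    then have "c - r L = (P / Q) ^ L * (c - r 0)" by blast
    moreover have "(P / Q) ^ L * (c - 1 / Q) \<le> (P / Q) ^ L * (c - r 0)"
      using r(1) assms by (intro mult_left_mono) auto
    moreover have "c < (P / Q) ^ L * (c - 1 / Q)"
      using L gap by (simp add: pos_divide_less_eq)
    ultimately show False
      using r(2) by linarith
  qed
  ultimately show thesis by (rule that)
qed

section \<open>The carry sequence of a Z-number\<close>

text \<open>
  Comparing integer and fractional parts in \<open>q x\<^sub>n\<^sub>+\<^sub>1 = p x\<^sub>n\<close>, where \<open>x\<^sub>n = x (p/q)\<^sup>n\<close>, gives
  \<open>q y\<^sub>n\<^sub>+\<^sub>1 - p y\<^sub>n = p r\<^sub>n - q r\<^sub>n\<^sub>+\<^sub>1\<close>. The left side is an integer. The right side exceeds \<open>-1\<close>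
  because \<open>r\<^sub>n\<^sub>+\<^sub>1 < 1/q\<close>, and it is less than \<open>q\<close> because \<open>p r\<^sub>n \<le> p/q < q\<close>. So it is a letter
  below \<open>q\<close>.
\<close>

lemma Z_number_carries:
  fixes x :: real
  assumes "0 < q" "p < q\<^sup>2" and Z: "Z_number p q x"
  obtains y a :: "nat \<Rightarrow> nat" and r :: "nat \<Rightarrow> real"
  where "\<And>n. x * (real p / real q) ^ n = real (y n) + r n"
    and "\<And>n. 0 \<le> r n" and "\<And>n. r n < 1 / real q"
    and "\<And>n. q * y (Suc n) = p * y n + a n"
    and "\<And>n. a n < q"
    and "\<And>n. real (a n) = real p * r n - real q * r (Suc n)"
proof -
  define X where "X n = x * (real p / real q) ^ n" for n
  define r where "r n = frac (X n)" for n
  define y where "y n = nat \<lfloor>X n\<rfloor>" for n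
  define d where "d n = int q * int (y (Suc n)) - int p * int (y n)" for n
  have X_nonneg: "0 \<le> X n" for n
    using Z by (simp add: X_def Z_number_def)
  have split: "X n = real (y n) + r n" for n
    using X_nonneg[of n] by (simp add: y_def r_def frac_def)
  have r: "0 \<le> r n" "r n < 1 / real q" for n
    using Z by (auto simp: Z_number_def r_def X_def)
  have "real q * X (Suc n) = real p * X n" for n
    using \<open>0 < q\<close> by (simp add: X_def)
  then have d: "real_of_int (d n) = real p * r n - real q * r (Suc n)" for n
    unfolding split d_def by (simp add: algebra_simps)
  have "0 \<le> d n \<and> d n < int q" for n
  proof -
    have "real q * r (Suc n) < 1"
      using r(2)[of "Suc n"] \<open>0 < q\<close> by (simp add: field_simps)
    moreover have "0 \<le> real p * r n" using r(1) by simp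
    ultimately have "-1 < real_of_int (d n)"
      unfolding d by linarith
    moreover have "real p * r n < real q"
    proof -
      have "real p * r n \<le> real p * (1 / real q)"
        using r(2)[of n] by (intro mult_left_mono) auto
      also have "\<dots> < real q"
        using \<open>p < q\<^sup>2\<close> \<open>0 < q\<close>
        by (simp add: pos_divide_less_eq power2_eq_square flip: of_nat_mult)
      finally show ?thesis .
    qed
    moreover have "0 \<le> real q * r (Suc n)" using r(1) by simp
    ultimately have "real_of_int (d n) < real q"
      unfolding d by linarith
    with \<open>-1 < real_of_int (d n)\<close> show ?thesis by linarith
  qed
  then have d_bounds: "0 \<le> d n" "d n < int q" for n by auto
  have step: "q * y (Suc n) = p * y n + nat (d n)" for n
  proof -
    have "int (q * y (Suc n)) = int (p * y n + nat (d n))"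
      using d_bounds(1)[of n] by (simp add: d_def)
    then show ?thesis by (simp only: of_nat_eq_iff)
  qed
  show thesis
  proof (rule that[of y r "\<lambda>n. nat (d n)"])
    show "x * (real p / real q) ^ n = real (y n) + r n" for n
      using split[of n] by (simp add: X_def)
    show "nat (d n) < q" for n
      using d_bounds[of n] by linarith
    show "real (nat (d n)) = real p * r n - real q * r (Suc n)" for n
      using d_bounds(1)[of n] d[of n] by simp
  qed (fact r step)+
qed

theorem theorem1p5:
  fixes p q :: nat
  assumes "1 < q" and "q < p" and "coprime p q" and "p < q\<^sup>2"
    and "\<And>u. u \<in> lang_pq p q \<Longrightarrow> u \<noteq> [] \<Longrightarrow> normal_word {0..<q} (wmin_pq p q u)"
  shows "\<not> (\<exists>x::real. Z_number p q x)"
proof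
  assume "\<exists>x::real. Z_number p q x"
  then obtain x :: real where Z: "Z_number p q x" ..
  interpret rational_base p q
    using assms(1-3) by unfold_locales auto
  obtain y a :: "nat \<Rightarrow> nat" and r :: "nat \<Rightarrow> real"
    where X: "\<And>n. x * (real p / real q) ^ n = real (y n) + r n"
      and r_nonneg: "\<And>n. 0 \<le> r n" and r_less: "\<And>n. r n < 1 / real q"
      and step: "\<And>n. q * y (Suc n) = p * y n + a n"
      and a_less: "\<And>n. a n < q"
      and a_r: "\<And>n. real (a n) = real p * r n - real q * r (Suc n)"
    using Z_number_carries[OF q_pos \<open>p < q\<^sup>2\<close> Z] by metis
  have "0 < x"
    using Z by (simp add: Z_number_def)
  have "1 < real p / real q"
    using assms(1,2) by simp
  \<comment> \<open>The minimal words at hand need a non-empty seed, so wait until \<open>x (p/q)\<^sup>n > 1\<close>.\<close>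
  then obtain n where n: "1 / x < (real p / real q) ^ n"
    using real_arch_pow by blast
  have "1 < x * (real p / real q) ^ n"
    using n \<open>0 < x\<close> by (simp add: field_simps)
  moreover have "1 / real q < 1"
    using assms(1) by simp
  with r_less[of n] have "r n < 1"
    by (rule less_trans)
  ultimately have "y n \<noteq> 0"
    using X[of n] by auto
  define u where "u = rep_pq p q (y n)"
  have u: "is_rep p q (y n) u"
    by (simp add: u_def is_rep_rep_pq)
  with \<open>y n \<noteq> 0\<close> have "u \<noteq> []"
    by (auto simp: is_rep_def)
  have "wmin_pq p q u = (\<lambda>k. a (n + k))"
    using u \<open>u \<noteq> []\<close> step a_less by (intro wmin_pq_eqI[of "\<lambda>k. y (n + k)"]) simp_all
  moreover have "u \<in> lang_pq p q"
    by (simp add: u_def lang_pq_def)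
  ultimately have normal: "normal_word {0..<q} (\<lambda>k. a (n + k))"
    using assms(5) \<open>u \<noteq> []\<close> by metis
  have "real p < (real q)\<^sup>2"
    using assms(4) by (simp flip: of_nat_power)
  then obtain L where "1 \<le> L"
    and L: "\<And>r :: nat \<Rightarrow> real. \<lbrakk>r 0 < 1 / real q; 0 \<le> r L;
      \<And>i. i < L \<Longrightarrow> real p * r i - real q * r (Suc i) = real q - 1\<rbrakk> \<Longrightarrow> False"
    using top_letter_runs_bounded[of "real q" "real p"] assms(1,2) by auto
  have "replicate L (q - 1) \<in> words_of_length {0..<q} L"
    using assms(1) by (auto simp: words_of_length_def)
  then obtain m where m: "map (\<lambda>k. a (n + k)) [m..<m + L] = replicate L (q - 1)"
    using normal_word_factor_occurs[OF normal] \<open>1 \<le> L\<close> assms(1) by auto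
  have run: "a (n + m + i) = q - 1" if "i < L" for i
    using arg_cong[OF m, of "\<lambda>v. v ! i"] that by (simp add: add.assoc)
  show False
  proof (rule L[of "\<lambda>i. r (n + m + i)"])
    fix i assume "i < L"
    then show "real p * r (n + m + i) - real q * r (n + m + Suc i) = real q - 1"
      using a_r[of "n + m + i"] run[of i] assms(1) by (simp add: of_nat_diff)
  qed (simp_all add: r_less r_nonneg)
qed

end
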